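(* Let $G=(X,Y,E)$ be a chain graph without isolated vertices, with a chain partition of length $k$. Then (a) $\chi_{td}(G)=2$ if and only if $k=1$; (b) $\chi_{td}(G)=3$ if and only if $k=2$; (c) $\chi_{td}(G)=4$ if and only if $k\ge 3$.
   Context: A bipartite graph $G=(X,Y,E)$ (parts $X,Y$ independent) is a chain graph if the vertices of $X$ can be ordered $x_1,\dots,x_{n_1}$ with $N(x_1)\subseteq N(x_2)\subseteq\cdots\subseteq N(x_{n_1})$. Its chain partition is obtained as follows: partition $X$ into classes $X_1,\dots,X_k$ of vertices with equal neighbourhoods, indexed so that $N(X_1)\subsetneq N(X_2)\subsetneq\cdots\subsetneq N(X_k)$; set $Y_1=N(X_1)$ and $Y_i=N(X_i)\setminus\bigcup_{j<i}N(X_j)$ for $2\le i\le k$; $k$ is the length of the chain partition. A total dominator coloring (TD-coloring) is a proper vertex coloring in which every vertex is adjacent to all vertices of some color class; $\chi_{td}(G)$ is the minimum number of colors of a TD-coloring. *)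

theory Defs
  imports Main
begin

text \<open>Graphs are finite and simple; an edge is the two-element set of its end points.\<close>

definition bipartite_graph :: "'a set \<Rightarrow> 'a set \<Rightarrow> 'a set set \<Rightarrow> bool" where
  "bipartite_graph X Y E \<longleftrightarrow>
     finite X \<and> finite Y \<and> X \<inter> Y = {} \<and> E \<subseteq> {{x, y} | x y. x \<in> X \<and> y \<in> Y}"

definition nbhd :: "'a set set \<Rightarrow> 'a \<Rightarrow> 'a set" where
  "nbhd E v = {u. {u, v} \<in> E}"

definition nbhd_set :: "'a set set \<Rightarrow> 'a set \<Rightarrow> 'a set" where
  "nbhd_set E S = (\<Union>v\<in>S. nbhd E v)"

definition no_isolated_vertices :: "'a set \<Rightarrow> 'a set set \<Rightarrow> bool" where
  "no_isolated_vertices V E \<longleftrightarrow> (\<forall>v\<in>V. nbhd E v \<noteq> {})"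

definition chain_graph :: "'a set \<Rightarrow> 'a set \<Rightarrow> 'a set set \<Rightarrow> bool" where
  "chain_graph X Y E \<longleftrightarrow> bipartite_graph X Y E \<and>
     (\<exists>xs. distinct xs \<and> set xs = X \<and> sorted_wrt (\<lambda>u v. nbhd E u \<subseteq> nbhd E v) xs)"

text \<open>
  The classes are \<open>A 1, \<dots>, A k\<close> on the \<open>X\<close> side and \<open>B 1, \<dots>, B k\<close> on the \<open>Y\<close> side;
  values of \<open>A\<close> and \<open>B\<close> outside \<open>{1..k}\<close> are irrelevant. The strict inclusions make \<open>A\<close>
  injective on \<open>{1..k}\<close>, so \<open>k\<close> is the number of classes.
\<close>

definition chain_partition ::
    "'a set \<Rightarrow> 'a set set \<Rightarrow> nat \<Rightarrow> (nat \<Rightarrow> 'a set) \<Rightarrow> (nat \<Rightarrow> 'a set) \<Rightarrow> bool" where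
  "chain_partition X E k A B \<longleftrightarrow>
     A ` {1..k} = X // {(u, v). u \<in> X \<and> v \<in> X \<and> nbhd E u = nbhd E v} \<and>
     (\<forall>i\<in>{1..k}. \<forall>j\<in>{1..k}. i < j \<longrightarrow> nbhd_set E (A i) \<subset> nbhd_set E (A j)) \<and>
     (1 \<le> k \<longrightarrow> B 1 = nbhd_set E (A 1)) \<and>
     (\<forall>i\<in>{2..k}. B i = nbhd_set E (A i) - (\<Union>j\<in>{1..<i}. nbhd_set E (A j)))"

definition proper_coloring :: "'a set \<Rightarrow> 'a set set \<Rightarrow> ('a \<Rightarrow> nat) \<Rightarrow> bool" where
  "proper_coloring V E c \<longleftrightarrow> (\<forall>u\<in>V. \<forall>v\<in>V. {u, v} \<in> E \<longrightarrow> c u \<noteq> c v)"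

text \<open>Only colors that occur on \<open>V\<close> count, so color classes are nonempty.\<close>

definition td_coloring :: "'a set \<Rightarrow> 'a set set \<Rightarrow> ('a \<Rightarrow> nat) \<Rightarrow> bool" where
  "td_coloring V E c \<longleftrightarrow> proper_coloring V E c \<and>
     (\<forall>v\<in>V. \<exists>i\<in>c ` V. \<forall>u\<in>V. c u = i \<longrightarrow> {u, v} \<in> E)"

definition td_chromatic_number :: "'a set \<Rightarrow> 'a set set \<Rightarrow> nat" where
  "td_chromatic_number V E = (LEAST n. \<exists>c. td_coloring V E c \<and> card (c ` V) = n)"

text \<open>
  The minimum is over a nonempty set for the graphs considered here: without isolated
  vertices, giving all vertices different colors is a TD-coloring.
\<close>

lemma td_coloring_exists:
  assumes "bipartite_graph X Y E" and "no_isolated_vertices (X \<union> Y) E"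
  shows "\<exists>c. td_coloring (X \<union> Y) E c"
proof -
  from assms(1) have "finite (X \<union> Y)"
    by (simp add: bipartite_graph_def)
  then obtain c :: "'a \<Rightarrow> nat" where c: "inj_on c (X \<union> Y)"
    using finite_imp_inj_to_nat_seg by blast
  have ends: "u \<in> X \<union> Y \<and> v \<in> X \<union> Y \<and> u \<noteq> v" if "{u, v} \<in> E" for u v
    using assms(1) that by (fastforce simp: bipartite_graph_def doubleton_eq_iff)
  have "proper_coloring (X \<union> Y) E c"
    unfolding proper_coloring_def using ends c by (meson inj_onD)
  moreover have "\<exists>i\<in>c ` (X \<union> Y). \<forall>u\<in>X \<union> Y. c u = i \<longrightarrow> {u, v} \<in> E"
    if v: "v \<in> X \<union> Y" for v
  proof -
    obtain w where w: "{w, v} \<in> E"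
      using assms(2) v by (auto simp: no_isolated_vertices_def nbhd_def)
    then have "w \<in> X \<union> Y" using ends by blast
    then show ?thesis
      using w c by (intro bexI[of _ "c w"]) (auto dest: inj_onD)
  qed
  ultimately show ?thesis
    unfolding td_coloring_def by blast
qed

end

theory Submission
  imports Defs
begin

text \<open>
  Let \<open>P = N(X\<^sub>1)\<close> be the smallest neighbourhood of a vertex of \<open>X\<close> and \<open>Q = X\<^sub>k\<close> the smallest
  neighbourhood of a vertex of \<open>Y\<close>. Every vertex of \<open>X\<close> is adjacent to all of \<open>P\<close> and every vertex
  of \<open>Y\<close> to all of \<open>Q\<close>, so any proper coloring that has \<open>P\<close> and \<open>Q\<close> among its color classes is a
  TD-coloring. Conversely, the vertices attaining these neighbourhoods force every TD-coloring to
  have a class inside \<open>P\<close> and a class inside \<open>Q\<close>. The number of further colors is therefore the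
  chromatic number of the graph induced on \<open>(X - Q) \<union> (Y - P)\<close>: this graph is empty for \<open>k = 1\<close>,
  nonempty without edges for \<open>k = 2\<close>, and has an edge for \<open>k \<ge> 3\<close>.
\<close>

lemma bipartite_graph_edgeD:
  assumes "bipartite_graph X Y E" and "{u, v} \<in> E"
  shows "u \<in> X \<and> v \<in> Y \<or> u \<in> Y \<and> v \<in> X"
  using assms by (fastforce simp: bipartite_graph_def doubleton_eq_iff)

text \<open>The witness only needs at most \<open>n\<close> colors: the lower bound then gives
  equality, so it never has to be shown that every intended color occurs.\<close>

lemma td_chromatic_number_eqI:
  assumes "td_coloring V E c" and "card (c ` V) \<le> n"
    and "\<And>c. td_coloring V E c \<Longrightarrow> n \<le> card (c ` V)"
  shows "td_chromatic_number V E = n"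
  unfolding td_chromatic_number_def
proof (rule Least_equality)
  show "\<exists>c. td_coloring V E c \<and> card (c ` V) = n"
    using assms by (metis le_antisym)
qed (use assms(3) in blast)

text \<open>This isolates what the coloring arguments use of a chain graph: on each side, a vertex
  whose neighbourhood is least under inclusion. The two sides play symmetric roles, and
  \<open>k\<close> enters only afterwards.\<close>

locale bipartite_min_nbhds =
  fixes X Y :: "'a set" and E :: "'a set set" and a b :: 'a
  assumes bipartite: "bipartite_graph X Y E"
    and no_isolated: "no_isolated_vertices (X \<union> Y) E"
    and a_in: "a \<in> X" and b_in: "b \<in> Y"
    and a_min: "\<And>x. x \<in> X \<Longrightarrow> nbhd E a \<subseteq> nbhd E x"
    and b_min: "\<And>y. y \<in> Y \<Longrightarrow> nbhd E b \<subseteq> nbhd E y"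
begin

abbreviation "V \<equiv> X \<union> Y"
abbreviation "P \<equiv> nbhd E a"
abbreviation "Q \<equiv> nbhd E b"

lemma finite_V: "finite V" and disjoint: "X \<inter> Y = {}"
  using bipartite by (auto simp: bipartite_graph_def)

lemma P_subset: "P \<subseteq> Y" and Q_subset: "Q \<subseteq> X"
  using bipartite_graph_edgeD[OF bipartite] a_in b_in disjoint by (fastforce simp: nbhd_def)+

lemma P_nonempty: "P \<noteq> {}" and Q_nonempty: "Q \<noteq> {}"
  using no_isolated a_in b_in by (auto simp: no_isolated_vertices_def)

lemma td_coloringI:
  assumes "proper_coloring V E c"
    and "p \<in> c ` V" "q \<in> c ` V"
    and "\<And>v. v \<in> V \<Longrightarrow> c v = p \<Longrightarrow> v \<in> P"
    and "\<And>v. v \<in> V \<Longrightarrow> c v = q \<Longrightarrow> v \<in> Q"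
  shows "td_coloring V E c"
  unfolding td_coloring_def
proof (intro conjI ballI assms(1))
  fix v assume "v \<in> V"
  then consider "v \<in> X" | "v \<in> Y" by blast
  then show "\<exists>i\<in>c ` V. \<forall>u\<in>V. c u = i \<longrightarrow> {u, v} \<in> E"
  proof cases
    case 1
    then show ?thesis using assms a_min[of v] by (intro bexI[of _ p]) (auto simp: nbhd_def)
  next
    case 2
    then show ?thesis using assms b_min[of v] by (intro bexI[of _ q]) (auto simp: nbhd_def)
  qed
qed

lemma td_coloring_classesE:
  assumes "td_coloring V E c"
  obtains p q where "p \<in> c ` V" "q \<in> c ` V" "p \<noteq> q"
    and "\<And>v. v \<in> V \<Longrightarrow> c v = p \<Longrightarrow> v \<in> P"
    and "\<And>v. v \<in> V \<Longrightarrow> c v = q \<Longrightarrow> v \<in> Q"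
proof -
  have dom: "\<exists>i\<in>c ` V. \<forall>u\<in>V. c u = i \<longrightarrow> u \<in> nbhd E v" if "v \<in> V" for v
    using assms that by (simp add: td_coloring_def nbhd_def)
  obtain p where p: "p \<in> c ` V" "\<And>v. v \<in> V \<Longrightarrow> c v = p \<Longrightarrow> v \<in> P"
    using dom[of a] a_in by blast
  obtain q where q: "q \<in> c ` V" "\<And>v. v \<in> V \<Longrightarrow> c v = q \<Longrightarrow> v \<in> Q"
    using dom[of b] b_in by blast
  \<comment> \<open>Both classes are nonempty, and they lie on opposite sides of the
    bipartition.\<close>
  have "p \<noteq> q"
    using p q P_subset Q_subset disjoint by blast
  with p q that show thesis by blast
qed

section \<open>Lower bounds on the number of colors\<close>

lemma td_coloring_card_ge_2:
  assumes "td_coloring V E c"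
  shows "2 \<le> card (c ` V)"
proof -
  obtain p q where "p \<in> c ` V" "q \<in> c ` V" "p \<noteq> q"
    using td_coloring_classesE[OF assms] by metis
  then have "card {p, q} \<le> card (c ` V)"
    using finite_V by (intro card_mono) auto
  with \<open>p \<noteq> q\<close> show ?thesis by simp
qed

text \<open>A vertex of \<open>X - Q\<close> can be neither in the class inside \<open>Q\<close> nor
  in the class inside \<open>P\<close>, which is part of \<open>Y\<close>; it needs a third
  color.\<close>

lemma td_coloring_card_ge_3:
  assumes "td_coloring V E c" and "X \<noteq> Q"
  shows "3 \<le> card (c ` V)"
proof -
  obtain p q where pq: "p \<in> c ` V" "q \<in> c ` V" "p \<noteq> q"
    and p: "\<And>v. v \<in> V \<Longrightarrow> c v = p \<Longrightarrow> v \<in> P"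
    and q: "\<And>v. v \<in> V \<Longrightarrow> c v = q \<Longrightarrow> v \<in> Q"
    by (rule td_coloring_classesE[OF assms(1)]) blast
  obtain x where x: "x \<in> X" "x \<notin> Q"
    using assms(2) Q_subset by blast
  have "c x \<noteq> p" "c x \<noteq> q"
    using p[of x] q[of x] x P_subset disjoint by blast+
  moreover have "card {p, q, c x} \<le> card (c ` V)"
    using finite_V pq x by (intro card_mono) auto
  ultimately show ?thesis using pq by auto
qed

lemma td_coloring_card_ge_4:
  assumes "td_coloring V E c" and x: "x \<in> X - Q" and y: "y \<in> Y - P" and "{x, y} \<in> E"
  shows "4 \<le> card (c ` V)"
proof -
  obtain p q where pq: "p \<in> c ` V" "q \<in> c ` V" "p \<noteq> q"
    and p: "\<And>v. v \<in> V \<Longrightarrow> c v = p \<Longrightarrow> v \<in> P"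
    and q: "\<And>v. v \<in> V \<Longrightarrow> c v = q \<Longrightarrow> v \<in> Q"
    by (rule td_coloring_classesE[OF assms(1)]) blast
  have "c x \<noteq> p" "c x \<noteq> q" "c y \<noteq> p" "c y \<noteq> q"
    using p[of x] q[of x] p[of y] q[of y] x y P_subset Q_subset disjoint by blast+
  moreover have "c x \<noteq> c y"
    using assms by (auto simp: td_coloring_def proper_coloring_def)
  moreover have "card {p, q, c x, c y} \<le> card (c ` V)"
    using finite_V pq x y by (intro card_mono) auto
  ultimately show ?thesis using pq by auto
qed

section \<open>Colorings attaining the bounds\<close>

definition class_coloring :: "nat \<Rightarrow> nat \<Rightarrow> 'a \<Rightarrow> nat" where
  "class_coloring m n v = (if v \<in> P then 0 else if v \<in> Q then 1 else if v \<in> X then m else n)"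

text \<open>With \<open>m\<close> and \<open>n\<close> at least 2, the classes of 0 and 1 are
  exactly \<open>P\<close> and \<open>Q\<close>. The colors \<open>m\<close> of \<open>X - Q\<close>
  and \<open>n\<close> of \<open>Y - P\<close> may coincide as long as no edge joins these two
  sets.\<close>

lemma td_coloring_class_coloring:
  assumes "m \<ge> 2" "n \<ge> 2"
    and "\<And>x y. x \<in> X - Q \<Longrightarrow> y \<in> Y - P \<Longrightarrow> {x, y} \<in> E \<Longrightarrow> m \<noteq> n"
  shows "td_coloring V E (class_coloring m n)"
proof (rule td_coloringI[of _ 0 1])
  have "class_coloring m n x \<noteq> class_coloring m n y"
    if "x \<in> X" "y \<in> Y" "{x, y} \<in> E" for x y
  proof -
    have "x \<notin> P" "y \<notin> Q" "y \<notin> X"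
      using that P_subset Q_subset disjoint by blast+
    then show ?thesis
      using assms that by (auto simp: class_coloring_def)
  qed
  then show "proper_coloring V E (class_coloring m n)"
    unfolding proper_coloring_def
    using bipartite_graph_edgeD[OF bipartite] by (metis insert_commute)
  show "0 \<in> class_coloring m n ` V"
    using P_nonempty P_subset by (force simp: class_coloring_def)
  obtain v where "v \<in> Q" using Q_nonempty by blast
  moreover from this have "v \<in> V" "v \<notin> P" using P_subset Q_subset disjoint by blast+
  ultimately show "1 \<in> class_coloring m n ` V"
    by (force simp: class_coloring_def)
qed (use assms in \<open>auto simp: class_coloring_def split: if_splits\<close>)

lemma td_chromatic_number_2:
  assumes "X = Q"
  shows "td_chromatic_number V E = 2"
proof (rule td_chromatic_number_eqI)
  show "td_coloring V E (class_coloring 2 2)"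
    using assms by (intro td_coloring_class_coloring) auto
  \<comment> \<open>Here \<open>a\<close> itself lies in \<open>Q\<close>, so it is adjacent to all
    of \<open>Y\<close>; nothing remains outside \<open>P\<close> and \<open>Q\<close>, and color 2
    does not occur.\<close>
  have "Y \<subseteq> P"
  proof
    fix y assume "y \<in> Y"
    then have "a \<in> nbhd E y" using b_min a_in assms by blast
    then show "y \<in> P" by (simp add: nbhd_def insert_commute)
  qed
  then have "V \<subseteq> P \<union> Q"
    using assms by blast
  then have "class_coloring 2 2 ` V \<subseteq> {0, 1}"
    unfolding class_coloring_def by force
  then have "card (class_coloring 2 2 ` V) \<le> card {0, 1 :: nat}"
    by (intro card_mono) auto
  then show "card (class_coloring 2 2 ` V) \<le> 2" by simp
qed (rule td_coloring_card_ge_2)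

lemma td_chromatic_number_3:
  assumes "X \<noteq> Q" and "\<And>x y. x \<in> X - Q \<Longrightarrow> y \<in> Y - P \<Longrightarrow> {x, y} \<notin> E"
  shows "td_chromatic_number V E = 3"
proof (rule td_chromatic_number_eqI)
  show "td_coloring V E (class_coloring 2 2)"
    using assms by (intro td_coloring_class_coloring) auto
  have "card (class_coloring 2 2 ` V) \<le> card {0, 1, 2 :: nat}"
    by (intro card_mono) (auto simp: class_coloring_def)
  then show "card (class_coloring 2 2 ` V) \<le> 3" by simp
qed (rule td_coloring_card_ge_3[OF _ assms(1)])

lemma td_chromatic_number_4:
  assumes "x \<in> X - Q" "y \<in> Y - P" "{x, y} \<in> E"
  shows "td_chromatic_number V E = 4"
proof (rule td_chromatic_number_eqI)
  show "td_coloring V E (class_coloring 2 3)"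
    by (intro td_coloring_class_coloring) auto
  have "card (class_coloring 2 3 ` V) \<le> card {0, 1, 2, 3 :: nat}"
    by (intro card_mono) (auto simp: class_coloring_def)
  then show "card (class_coloring 2 3 ` V) \<le> 4" by simp
qed (rule td_coloring_card_ge_4[OF _ assms])

end

section \<open>From the chain partition to the two vertices\<close>

lemma td_chromatic_number_empty: "td_chromatic_number {} E = 0"
  by (rule td_chromatic_number_eqI[where c = "\<lambda>_. 0"])
    (auto simp: td_coloring_def proper_coloring_def)

text \<open>All members of a class share one neighbourhood, so the union
  \<open>nbhd_set E (A i)\<close> can be replaced by the neighbourhood of any
  representative.\<close>

lemma chain_partition_classes:
  assumes "chain_partition X E k A B"
  shows "(\<Union>i\<in>{1..k}. A i) = X"
    and "\<And>i. i \<in> {1..k} \<Longrightarrow> A i \<noteq> {}"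
    and "\<And>i x. i \<in> {1..k} \<Longrightarrow> x \<in> A i \<Longrightarrow> nbhd E x = nbhd_set E (A i)"
proof -
  define R where "R = {(u, v). u \<in> X \<and> v \<in> X \<and> nbhd E u = nbhd E v}"
  have R: "equiv X R"
    by (auto simp: R_def equiv_def refl_on_def sym_def trans_def)
  have A: "A ` {1..k} = X // R"
    using assms by (simp add: chain_partition_def R_def)
  show "(\<Union>i\<in>{1..k}. A i) = X"
    using Union_quotient[OF R] by (simp flip: A)
  fix i assume "i \<in> {1..k}"
  then have Ai: "A i \<in> X // R"
    using A by blast
  then show "A i \<noteq> {}"
    using R in_quotient_imp_non_empty by metis
  fix x assume x: "x \<in> A i"
  then have "nbhd E u = nbhd E x" if "u \<in> A i" for u
    using quotient_eq_iff[OF R Ai Ai that x] that by (simp add: R_def)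
  then show "nbhd E x = nbhd_set E (A i)"
    unfolding nbhd_set_def using x by blast
qed

theorem theorem7:
  fixes X Y :: "'a set" and E :: "'a set set" and k :: nat and A B :: "nat \<Rightarrow> 'a set"
  assumes "chain_graph X Y E"
    and "no_isolated_vertices (X \<union> Y) E"
    and "chain_partition X E k A B"
  shows "(td_chromatic_number (X \<union> Y) E = 2 \<longleftrightarrow> k = 1) \<and>
         (td_chromatic_number (X \<union> Y) E = 3 \<longleftrightarrow> k = 2) \<and>
         (td_chromatic_number (X \<union> Y) E = 4 \<longleftrightarrow> k \<ge> 3)"
proof -
  define N where "N i = nbhd_set E (A i)" for i
  have bip: "bipartite_graph X Y E"
    using assms(1) by (simp add: chain_graph_def)
  note edge = bipartite_graph_edgeD[OF bip]
  have disj: "X \<inter> Y = {}"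
    using bip by (simp add: bipartite_graph_def)
  note nbhd_A = chain_partition_classes(3)[OF assms(3), folded N_def]
  have A_ne: "A i \<noteq> {}" if "i \<in> {1..k}" for i
    using chain_partition_classes(2)[OF assms(3)] that by blast
  have A_sub: "A i \<subseteq> X" if "i \<in> {1..k}" for i
    using chain_partition_classes(1)[OF assms(3)] that by blast
  have X_cover: "\<exists>i\<in>{1..k}. x \<in> A i" if "x \<in> X" for x
    using chain_partition_classes(1)[OF assms(3)] that by blast
  have N_less: "N i \<subset> N j" if "i \<in> {1..k}" "j \<in> {1..k}" "i < j" for i j
    using assms(3) that by (simp add: chain_partition_def N_def)
  have N_le: "N i \<subseteq> N j" if "i \<in> {1..k}" "j \<in> {1..k}" "i \<le> j" for i j
    using N_less[OF that(1,2)] that(3) by (cases "i = j") auto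
  have N_sub: "N i \<subseteq> Y" if i: "i \<in> {1..k}" for i
  proof -
    obtain x where x: "x \<in> A i" using A_ne[OF i] by blast
    then have "nbhd E x \<subseteq> Y" using edge A_sub[OF i] disj by (fastforce simp: nbhd_def)
    then show ?thesis using nbhd_A[OF i x] by simp
  qed
  have X_nbhd: "\<exists>u\<in>X. y \<in> nbhd E u" if "y \<in> Y" for y
  proof -
    obtain u where u: "{u, y} \<in> E"
      using assms(2) \<open>y \<in> Y\<close> by (auto simp: no_isolated_vertices_def nbhd_def)
    then have "u \<in> X" using edge[OF u] disj \<open>y \<in> Y\<close> by blast
    then show ?thesis using u by (auto simp: nbhd_def insert_commute)
  qed
  show ?thesis
  proof (cases "k = 0")
    \<comment> \<open>The hypotheses admit the empty graph; its number is 0, so all three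
      equivalences hold with both sides false.\<close>
    case True
    then have "X = {}" using X_cover by auto
    then have "Y = {}" using X_nbhd by blast
    with \<open>X = {}\<close> True show ?thesis by (simp add: td_chromatic_number_empty)
  next
    case False
    then have k1: "1 \<in> {1..k}" and kk: "k \<in> {1..k}" by auto
    have Y_sub: "Y \<subseteq> N k"
    proof
      fix y assume "y \<in> Y"
      then obtain u where u: "u \<in> X" "y \<in> nbhd E u" using X_nbhd by blast
      then obtain i where i: "i \<in> {1..k}" "u \<in> A i" using X_cover by blast
      then show "y \<in> N k" using u nbhd_A[OF i] N_le[OF i(1) kk] by auto
    qed
    obtain a where a: "a \<in> A 1" using A_ne[OF k1] by blast
    have P: "nbhd E a = N 1" using nbhd_A[OF k1 a] .
    \<comment> \<open>The vertex \<open>b\<close> is taken from the last class on the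
      \<open>Y\<close> side. For \<open>k = 1\<close> any neighbour of \<open>a\<close> will do;
      otherwise it suffices to avoid \<open>N (k - 1)\<close>, which contains all earlier
      \<open>N i\<close>.\<close>
    obtain b where b: "b \<in> N k" "\<And>i. i \<in> {1..k} \<Longrightarrow> i < k \<Longrightarrow> b \<notin> N i"
    proof (cases "k = 1")
      case True
      have "nbhd E a \<noteq> {}"
        using assms(2) a A_sub[OF k1] by (auto simp: no_isolated_vertices_def)
      then show thesis using that P True by auto
    next
      case False
      with \<open>k \<noteq> 0\<close> have k': "k - 1 \<in> {1..k}" by auto
      obtain b where "b \<in> N k" "b \<notin> N (k - 1)"
        using N_less[OF k' kk] False \<open>k \<noteq> 0\<close> by auto
      then show thesis using that[of b] N_le[OF _ k'] by fastforce
    qed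
    have Q: "nbhd E b = A k"
    proof (intro equalityI subsetI)
      fix x assume x: "x \<in> nbhd E b"
      then have "b \<in> nbhd E x" by (simp add: nbhd_def insert_commute)
      moreover have "x \<in> X" using x edge disj b(1) N_sub[OF kk] by (fastforce simp: nbhd_def)
      then obtain i where i: "i \<in> {1..k}" "x \<in> A i" using X_cover by blast
      ultimately have "b \<in> N i" using nbhd_A by blast
      \<comment> \<open>By the choice of \<open>b\<close>, a class adjacent to it can only be the
        last one.\<close>
      then have "i = k" using b(2)[OF i(1)] i(1) by fastforce
      then show "x \<in> A k" using i by simp
    next
      fix x assume "x \<in> A k"
      then show "x \<in> nbhd E b" using b(1) nbhd_A[OF kk, of x] by (auto simp: nbhd_def insert_commute)
    qed
    interpret bipartite_min_nbhds X Y E a b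
    proof
      show "a \<in> X" using a A_sub[OF k1] by blast
      show "b \<in> Y" using b(1) N_sub[OF kk] by blast
      show "nbhd E a \<subseteq> nbhd E x" if "x \<in> X" for x
      proof -
        obtain i where i: "i \<in> {1..k}" "x \<in> A i" using X_cover \<open>x \<in> X\<close> by blast
        then show ?thesis using nbhd_A[OF i] N_le[OF k1 i(1)] P by simp
      qed
      show "nbhd E b \<subseteq> nbhd E y" if "y \<in> Y" for y
      proof
        fix x assume "x \<in> nbhd E b"
        \<comment> \<open>Vertices of \<open>A k\<close> are adjacent to all of \<open>Y\<close>,
          because \<open>Y\<close> is contained in \<open>N k\<close>.\<close>
        then have "y \<in> nbhd E x" using Q nbhd_A[OF kk] Y_sub \<open>y \<in> Y\<close> by blast
        then show "x \<in> nbhd E y" by (simp add: nbhd_def insert_commute)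
      qed
    qed (fact bip assms(2))+
    have not_Ak: "x \<notin> A k" if "i \<in> {1..k}" "i < k" "x \<in> A i" for i x
      using nbhd_A[OF that(1,3)] nbhd_A[OF kk, of x] N_less[OF that(1) kk that(2)] by auto
    \<comment> \<open>Each case determines the number exactly, and the three values differ, so both
      directions of every equivalence follow.\<close>
    consider "k = 1" | "k = 2" | "k \<ge> 3" using False by linarith
    then show ?thesis
    proof cases
      case 1
      then have "X = nbhd E b" using Q chain_partition_classes(1)[OF assms(3)] by simp
      then show ?thesis using td_chromatic_number_2 1 by simp
    next
      case 2
      have "X \<noteq> nbhd E b"
        using Q a_in not_Ak[OF k1 _ a] 2 by auto
      moreover have "{x, y} \<notin> E" if "x \<in> X - nbhd E b" "y \<in> Y - nbhd E a" for x y
      proof -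
        obtain i where i: "i \<in> {1..k}" "x \<in> A i" using X_cover \<open>x \<in> X - nbhd E b\<close> by blast
        then have "i \<noteq> k" using that Q by blast
        then have "i = 1" using i(1) 2 by auto
        \<comment> \<open>Outside \<open>Q = A 2\<close> only \<open>A 1\<close> is left, and its
          vertices have no neighbours beyond \<open>P\<close>.\<close>
        then have "nbhd E x = nbhd E a" using nbhd_A[OF i] P by simp
        then show ?thesis using that by (auto simp: nbhd_def insert_commute)
      qed
      ultimately show ?thesis using td_chromatic_number_3 2 by simp
    next
      case 3
      then have k2: "2 \<in> {1..k}" by simp
      \<comment> \<open>The second class supplies the edge: \<open>2 < k\<close> keeps
        \<open>x\<close> out of \<open>Q = A k\<close>, and strictness of the chain gives it a
        neighbour \<open>y\<close> outside \<open>P = N 1\<close>.\<close>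
      obtain x where x: "x \<in> A 2" using A_ne[OF k2] by blast
      obtain y where y: "y \<in> N 2" "y \<notin> N 1" using N_less[OF k1 k2] by auto
      have "{x, y} \<in> E"
        using y(1) nbhd_A[OF k2 x] by (auto simp: nbhd_def insert_commute)
      moreover have "x \<in> X - nbhd E b"
        using x A_sub[OF k2] not_Ak[OF k2 _ x] 3 Q by auto
      moreover have "y \<in> Y - nbhd E a"
        using y N_sub[OF k2] P by blast
      ultimately show ?thesis using td_chromatic_number_4 3 by simp
    qed
  qed
qed

end
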